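(* Let $k$ be a positive integer. Let $K_1, K_2, \dots, K_k$ be distinct real quadratic fields. Then there exists a positive integer $n$ such that $I_{2n}^{2,r}$ contains a primitive element (over $\mathbb{Q}$) of every $K_i$, $i \in \{1,2,\dots,k\}$.
   Context: A real quadratic field is a subfield of $\mathbb{R}$ of degree two over $\mathbb{Q}$. For an integer $n \ge 1$, $$I_n^{2,r} := \{\alpha \in (0,1) \mid \alpha^2+n\alpha+c=0 \text{ for some } c \in \mathbb{Z},\ -n \le c \le -1\}.$$ *)

theory Defs
  imports Complex_Main "HOL-Algebra.Generated_Fields" "HOL-Algebra.Algebraic_Closure_Type"
begin

abbreviation real_ring :: "real ring" where
  "real_ring \<equiv> ring_of_type_algebra"

definition real_quadratic_field :: "real set \<Rightarrow> bool" where
  "real_quadratic_field K \<longleftrightarrow> subfield K real_ring \<and> ring.dimension real_ring 2 \<rat> K"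

definition primitive_element :: "real \<Rightarrow> real set \<Rightarrow> bool" where
  "primitive_element \<alpha> K \<longleftrightarrow> generate_field real_ring (insert \<alpha> \<rat>) = K"

(* Called I_n^{2,r} in the literature; only used for n \<ge> 1. *)
definition I2r :: "nat \<Rightarrow> real set" where
  "I2r n = {\<alpha> \<in> {0<..<1}. \<exists>c::int. - int n \<le> c \<and> c \<le> -1 \<and>
              \<alpha>\<^sup>2 + real n * \<alpha> + real_of_int c = 0}"

end

theory Submission
  imports Defs "HOL-Analysis.Kronecker_Approximation_Theorem"
begin

text \<open>Write \<open>K\<^sub>i = \<rat>(\<surd>d\<^sub>i)\<close>. The elements of \<open>I\<^bsub>2n\<^esub>\<close> are the numbers \<open>\<surd>m - n\<close> with
  \<open>n\<^sup>2 < m < (n + 1)\<^sup>2\<close>, so it suffices to find one \<open>n\<close> such that \<open>(n, n + 1)\<close> contains an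
  integer multiple of each \<open>\<surd>d\<^sub>i\<close>. For a set \<open>A\<close> of indices let \<open>D\<^sub>A\<close> be the product of the \<open>d\<^sub>i\<close>
  with \<open>i \<in> A\<close>. Dirichlet's simultaneous approximation theorem gives integers \<open>a\<^sub>A\<close> such that the
  numbers \<open>x\<^sub>A = a\<^sub>A\<surd>D\<^sub>A\<close> are all very close to each other. With \<open>A'\<close> the symmetric difference of
  \<open>A\<close> and \<open>{i}\<close>, the sum \<open>b\<close> of the \<open>x\<^sub>A\<^sup>2\<close> is an integer, the sum of the \<open>x\<^sub>A x\<^bsub>A'\<^esub>\<close> is an integer
  multiple of \<open>\<surd>d\<^sub>i\<close>, and \<open>b\<close> exceeds the latter by half the sum of the \<open>(x\<^sub>A - x\<^bsub>A'\<^esub>)\<^sup>2\<close>, which is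
  small and positive. Hence \<open>n = b - 1\<close> works for all \<open>i\<close> at once; no linear independence of the
  \<open>\<surd>d\<^sub>i\<close> is needed.\<close>

section \<open>Simultaneous approximation and multiples of irrational square roots\<close>

text \<open>Dirichlet's theorem moved from indices below a bound to any finite index set; it is
  applied to a power set.\<close>

lemma Dirichlet_approx_finite:
  fixes \<theta> :: "'a \<Rightarrow> real"
  assumes "finite S" "\<epsilon> > 0"
  obtains q :: int and p where "q > 0" "\<And>s. s \<in> S \<Longrightarrow> \<bar>of_int q * \<theta> s - of_int (p s)\<bar> < \<epsilon>"
proof -
  obtain h where h: "bij_betw h {0..<card S} S"
    using ex_bij_betw_nat_finite[OF \<open>finite S\<close>] by blast
  define g where "g = inv_into {0..<card S} h"
  have g: "g s < card S" "h (g s) = s" if "s \<in> S" for s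
    using that bij_betw_inv_into_right[OF h that] bij_betwE[OF bij_betw_inv_into[OF h]]
    by (simp_all add: g_def)
  obtain N :: nat where N: "N > 0" "1 / N < \<epsilon>"
    by (metis \<open>\<epsilon> > 0\<close> gr_zeroI inverse_eq_divide real_arch_inverse)
  obtain q p where "0 < q"
    and "\<And>i. i < card S \<Longrightarrow> \<bar>of_int q * \<theta> (h i) - of_int (p i)\<bar> < 1 / N"
    using Dirichlet_approx_simult[OF N(1), of "card S" "\<theta> \<circ> h"] by (metis comp_apply)
  then show thesis
    using that[of q "p \<circ> g"] g N(2) by (metis comp_apply less_trans)
qed

text \<open>One \<open>n\<close> serves every \<open>i\<close> because \<open>b\<close> does not
  depend on \<open>i\<close>; only the pairing of \<open>A\<close> with \<open>flip A\<close>
  does.\<close>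

lemma irrational_sqrts_common_floor:
  fixes d :: "'a \<Rightarrow> nat"
  assumes "finite I" and irr: "\<And>i. i \<in> I \<Longrightarrow> sqrt (d i) \<notin> \<rat>"
  obtains n :: nat where "n > 0"
    "\<And>i. i \<in> I \<Longrightarrow> \<exists>t::int. n < t * sqrt (d i) \<and> t * sqrt (d i) < n + 1"
proof (cases "I = {}")
  \<comment> \<open>Here the construction could give \<open>b = 1\<close>, and ruling that out needs
    an element of \<open>I\<close>. Any positive \<open>n\<close> will do.\<close>
  case True
  then show thesis using that[of 1] by simp
next
  case False
  define S where "S = Pow I"
  define D where "D A = (\<Prod>i\<in>A. d i)" for A
  have finS: "finite S" using assms by (simp add: S_def)
  have dpos: "d i > 0" if "i \<in> I" for i
    using irr[OF that] by (intro gr0I) auto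
  have Dpos: "D A > 0" if "A \<in> S" for A
    unfolding D_def using that dpos by (auto simp: S_def intro!: prod_pos)
  define M where "M = (\<Sum>A\<in>S. sqrt (D A))"
  have M: "sqrt (D A) \<le> M" if "A \<in> S" for A
    unfolding M_def by (rule member_le_sum) (use that finS in auto)
  have emp: "{} \<in> S" "D {} = 1" by (auto simp: S_def D_def)
  have M1: "M \<ge> 1" using M[OF emp(1)] emp by simp
  define c where "c = real (card S)"
  have c1: "c \<ge> 1" using finS emp by (auto simp: c_def Suc_le_eq card_gt_0_iff)
  \<comment> \<open>Scaling an error below \<open>\<epsilon>\<close> by
    \<open>sqrt (D A) \<le> M\<close> leaves at most \<open>1 / (2 * c)\<close>. Two of the
    \<open>x A\<close> then differ by at most \<open>1 / c\<close>, so \<open>c\<close> squared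
    differences sum to at most 1.\<close>
  define \<epsilon> where "\<epsilon> = 1 / (2 * c * M)"
  have \<epsilon>: "0 < \<epsilon>" "\<epsilon> < 1" "\<epsilon> * M = 1 / (2 * c)"
    using c1 M1 mult_mono[of 1 c 1 M] by (auto simp: \<epsilon>_def field_simps)
  \<comment> \<open>Approximating the reciprocals makes every \<open>a A * sqrt (D A)\<close> close
    to the same integer \<open>q\<close>.\<close>
  obtain q :: int and a :: "'a set \<Rightarrow> int" where q: "q > 0"
    and a: "\<And>A. A \<in> S \<Longrightarrow> \<bar>q * (1 / sqrt (D A)) - a A\<bar> < \<epsilon>"
    using Dirichlet_approx_finite[OF finS \<epsilon>(1), of "\<lambda>A. 1 / sqrt (D A)"] by metis
  define x where "x A = a A * sqrt (D A)" for A
  have x: "\<bar>q - x A\<bar> \<le> 1 / (2 * c)" if "A \<in> S" for A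
  proof -
    have "q - x A = (q * (1 / sqrt (D A)) - a A) * sqrt (D A)"
      using Dpos[OF that] by (simp add: x_def field_simps)
    then have "\<bar>q - x A\<bar> = \<bar>q * (1 / sqrt (D A)) - a A\<bar> * sqrt (D A)"
      by (simp add: abs_mult)
    also have "\<dots> \<le> \<epsilon> * M"
      using a[OF that] M[OF that] \<epsilon>(1) by (intro mult_mono) auto
    finally show ?thesis using \<epsilon> by simp
  qed
  \<comment> \<open>Since \<open>D {} = 1\<close>, the integers \<open>q\<close> and
    \<open>a {}\<close> differ by less than 1.\<close>
  have x_emp: "x {} = q"
  proof -
    have "real_of_int \<bar>q - a {}\<bar> < 1" using a[OF emp(1)] \<epsilon>(2) emp by simp
    then have "a {} = q" by linarith
    then show ?thesis by (simp add: x_def emp)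
  qed
  define b where "b = (\<Sum>A\<in>S. (a A)\<^sup>2 * int (D A))"
  have b: "real_of_int b = (\<Sum>A\<in>S. (x A)\<^sup>2)"
    by (simp add: b_def x_def power_mult_distrib)
  have "b \<ge> 1"
  proof -
    have "(x {})\<^sup>2 \<le> (\<Sum>A\<in>S. (x A)\<^sup>2)"
      using finS emp by (intro member_le_sum) auto
    then have "q\<^sup>2 \<le> b" unfolding x_emp b[symmetric] by (simp flip: of_int_power)
    moreover have "q\<^sup>2 > 0" using q by simp
    ultimately show ?thesis by linarith
  qed
  have main: "\<exists>t::int. b - 1 < t * sqrt (d i) \<and> t * sqrt (d i) < b" if i: "i \<in> I" for i
  proof -
    define flip where "flip A = (if i \<in> A then A - {i} else insert i A)" for A
    have flip: "flip A \<in> S" "flip (flip A) = A" if "A \<in> S" for A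
      using that i by (auto simp: flip_def S_def)
    have bij: "bij_betw flip S S"
      by (rule bij_betw_byWitness[where f' = flip]) (use flip in auto)
    \<comment> \<open>\<open>D A * D (flip A)\<close> is \<open>d i\<close> times the square of
      \<open>D (A - {i})\<close>, so each product \<open>x A * x (flip A)\<close> is an integer
      multiple of \<open>sqrt (d i)\<close>.\<close>
    define t where "t = (\<Sum>A\<in>S. a A * a (flip A) * int (D (A - {i})))"
    have D: "sqrt (D A) * sqrt (D (flip A)) = D (A - {i}) * sqrt (d i)" if "A \<in> S" for A
    proof -
      have "finite A" using that assms(1) by (auto simp: S_def intro: finite_subset)
      then have ins: "D (insert i (A - {i})) = d i * D (A - {i})"
        unfolding D_def by (subst prod.insert) auto
      have "{A, flip A} = {A - {i}, insert i (A - {i})}"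
        by (auto simp: flip_def)
      then have "sqrt (D A) * sqrt (D (flip A)) = sqrt (D (A - {i})) * sqrt (D (insert i (A - {i})))"
        by (auto simp: doubleton_eq_iff mult.commute)
      then show ?thesis unfolding ins by (simp add: real_sqrt_mult)
    qed
    have t: "t * sqrt (d i) = (\<Sum>A\<in>S. x A * x (flip A))"
      unfolding t_def of_int_sum sum_distrib_right
    proof (rule sum.cong[OF refl])
      fix A assume A: "A \<in> S"
      have "x A * x (flip A) = a A * a (flip A) * (sqrt (D A) * sqrt (D (flip A)))"
        by (simp add: x_def)
      then show "real_of_int (a A * a (flip A) * int (D (A - {i}))) * sqrt (d i) = x A * x (flip A)"
        by (simp add: D[OF A])
    qed
    \<comment> \<open>As \<open>flip\<close> permutes \<open>S\<close>, both square terms in the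
      expansion of the squared differences sum to \<open>b\<close>.\<close>
    have "(\<Sum>A\<in>S. (x (flip A))\<^sup>2) = b"
      unfolding b by (rule sum.reindex_bij_betw[OF bij])
    then have diff: "2 * (b - t * sqrt (d i)) = (\<Sum>A\<in>S. (x A - x (flip A))\<^sup>2)"
      by (simp add: power2_diff sum.distrib sum_subtractf t b mult.assoc flip: sum_distrib_left)
    have "(\<Sum>A\<in>S. (x A - x (flip A))\<^sup>2) \<le> (\<Sum>A\<in>S. 1 / c)"
    proof (rule sum_mono)
      fix A assume A: "A \<in> S"
      have "\<bar>x A - x (flip A)\<bar> \<le> 1 / (2 * c) + 1 / (2 * c)"
        using x[OF A] x[OF flip(1)[OF A]] by linarith
      then have le: "\<bar>x A - x (flip A)\<bar> \<le> 1 / c" by simp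
      have "(x A - x (flip A))\<^sup>2 \<le> (1 / c)\<^sup>2"
        using power_mono[OF le, of 2] by simp
      also have "\<dots> \<le> 1 / c" using c1 by (simp add: power2_eq_square field_simps)
      finally show "(x A - x (flip A))\<^sup>2 \<le> 1 / c" .
    qed
    also have "\<dots> = 1" using c1 by (simp add: c_def)
    finally have "2 * (b - t * sqrt (d i)) \<le> 1" by (simp only: diff)
    then have up: "b - t * sqrt (d i) < 1" by argo
    \<comment> \<open>One nonzero summand gives strict positivity. At \<open>{}\<close>, equality
      would make \<open>sqrt (d i)\<close> a quotient of integers.\<close>
    have "x (flip {}) \<noteq> x {}"
    proof
      assume "x (flip {}) = x {}"
      then have "a {i} * sqrt (d i) = q" by (simp add: x_emp) (simp add: x_def flip_def D_def)
      moreover from this q have "a {i} \<noteq> 0" by auto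
      ultimately have "sqrt (d i) = q / a {i}" by (simp add: field_simps)
      then show False using irr[OF i] by simp
    qed
    then have "(\<Sum>A\<in>S. (x A - x (flip A))\<^sup>2) > 0"
      using finS emp by (intro sum_pos2[of _ "{}"]) auto
    then have "2 * (b - t * sqrt (d i)) > 0" by (simp only: diff)
    then have "t * sqrt (d i) < b" by argo
    moreover have "b - 1 < t * sqrt (d i)" using up by simp
    ultimately show ?thesis by blast
  qed
  \<comment> \<open>This makes \<open>n = b - 1\<close> positive: a positive integer multiple of
    \<open>sqrt (d i) \<ge> 1\<close> cannot lie in (0,1).\<close>
  have "b \<noteq> 1"
  proof
    assume "b = 1"
    moreover obtain i where i: "i \<in> I" using False by blast
    ultimately obtain t :: int where t: "0 < t * sqrt (d i)" "t * sqrt (d i) < 1"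
      using main[OF i] by auto
    have "sqrt (d i) \<ge> 1" using dpos[OF i] by simp
    moreover from this t(1) have "t \<ge> 1" by (simp add: zero_less_mult_iff)
    ultimately have "t * sqrt (d i) \<ge> 1" using mult_mono[of 1 "real_of_int t" 1 "sqrt (d i)"] by simp
    then show False using t(2) by simp
  qed
  then show thesis
    using that[of "nat (b - 1)"] main \<open>b \<ge> 1\<close> by auto
qed

section \<open>Real quadratic fields as \<rat>(sqrt d)\<close>

lemma real_ring_simps [simp]:
  "carrier real_ring = UNIV" "monoid.mult real_ring = (*)" "monoid.one real_ring = 1"
  "ring.zero real_ring = 0" "ring.add real_ring = (+)"
  by (simp_all add: ring_of_type_algebra_def)

interpretation real_ring: Ring.ring real_ring
  by (rule ring_from_type_algebra)

text \<open>Unfolding the inductive notion of dimension twice gives a basis \<open>u\<close>,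
  \<open>v\<close>; since 1 lies in \<open>K\<close>, it can be exchanged for one of the
  two.\<close>

lemma real_quadratic_field_basis:
  assumes "real_quadratic_field K"
  obtains w where "w \<notin> \<rat>" "K = {a + b * w |a b. a \<in> \<rat> \<and> b \<in> \<rat>}"
proof -
  have one: "1 \<in> K"
    using assms subringE(3)[OF subfieldE(1)] by (fastforce simp: real_quadratic_field_def)
  have step: "\<exists>v F. v \<notin> F \<and> real_ring.dimension n \<rat> F \<and> E = real_ring.line_extension \<rat> v F"
    if "real_ring.dimension (Suc n) \<rat> E" for n E
    using that by cases auto
  have zero: "E = {0}" if "real_ring.dimension 0 \<rat> E" for E
    using that by cases auto
  have "real_ring.dimension (Suc (Suc 0)) \<rat> K"
    using assms by (simp add: real_quadratic_field_def numeral_2_eq_2)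
  then obtain u v where u: "u \<noteq> 0"
    and v: "v \<notin> real_ring.line_extension \<rat> u {0}"
    and K: "K = real_ring.line_extension \<rat> v (real_ring.line_extension \<rat> u {0})"
    using step zero by (metis singletonI)
  have v: "v \<noteq> r * u" if "r \<in> \<rat>" for r
    using v that by (auto simp: real_ring.line_extension_mem_iff)
  have K: "x \<in> K \<longleftrightarrow> (\<exists>b\<in>\<rat>. \<exists>a\<in>\<rat>. x = b * v + a * u)" for x
  proof -
    have line: "real_ring.line_extension \<rat> u {0} = {a * u |a. a \<in> \<rat>}"
      by (auto simp: real_ring.line_extension_mem_iff)
    show ?thesis
      unfolding K real_ring.line_extension_mem_iff real_ring_simps line by blast
  qed
  obtain a b where ab: "a \<in> \<rat>" "b \<in> \<rat>" "1 = b * v + a * u"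
    using one K by blast
  show thesis
  \<comment> \<open>If \<open>b = 0\<close>, then \<open>u\<close> is rational and \<open>v\<close>
    serves as \<open>w\<close>. Otherwise 1 replaces \<open>v\<close>, and \<open>u\<close> serves
    as \<open>w\<close>.\<close>
  proof (cases "b = 0")
    case True
    then have "a * u = 1" using ab(3) by simp
    then have au: "a \<noteq> 0" "u = 1 / a" by (auto simp: eq_divide_eq mult.commute)
    show thesis
    proof (rule that[of v])
      show "v \<notin> \<rat>" using v[of "v * a"] ab(1) au by auto
      show "K = {a + b * v |a b. a \<in> \<rat> \<and> b \<in> \<rat>}" (is "_ = ?R")
      proof (intro subset_antisym subsetI)
        fix x assume "x \<in> K"
        then obtain r s where "r \<in> \<rat>" "s \<in> \<rat>" "x = s * v + r * u" using K by blast
        then show "x \<in> ?R" using ab(1)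
          by (intro CollectI exI[of _ "r / a"] exI[of _ s]) (simp add: au)
      next
        fix x assume "x \<in> ?R"
        then obtain r s where "r \<in> \<rat>" "s \<in> \<rat>" "x = r + s * v" by blast
        then show "x \<in> K" unfolding K using ab(1) au(1)
          by (intro bexI[of _ s] bexI[of _ "r * a"]) (simp_all add: au(2))
      qed
    qed
  next
    case False
    then have vb: "v = (1 - a * u) / b" using ab(3) by (simp add: field_simps)
    show thesis
    proof (rule that[of u])
      show "u \<notin> \<rat>"
      proof
        assume "u \<in> \<rat>"
        then have "v / u \<in> \<rat>" unfolding vb using ab by auto
        then show False using v[of "v / u"] u by simp
      qed
      show "K = {a + b * u |a b. a \<in> \<rat> \<and> b \<in> \<rat>}" (is "_ = ?R")
      proof (intro subset_antisym subsetI)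
        fix x assume "x \<in> K"
        then obtain r s where "r \<in> \<rat>" "s \<in> \<rat>" "x = s * v + r * u" using K by blast
        then show "x \<in> ?R" using ab(1,2) False
          by (intro CollectI exI[of _ "s / b"] exI[of _ "r - s * a / b"])
            (simp add: vb field_simps)
      next
        fix x assume "x \<in> ?R"
        then obtain r s where "r \<in> \<rat>" "s \<in> \<rat>" "x = r + s * u" by blast
        then show "x \<in> K" unfolding K using ab(1,2) False
          by (intro bexI[of _ "r * b"] bexI[of _ "s + r * a"])
            (simp_all add: vb field_simps)
      qed
    qed
  qed
qed

text \<open>For \<open>r = m / l\<close> take \<open>d = m * l\<close>, which is \<open>r\<close>
  times the square of \<open>l\<close>.\<close>

lemma rational_eq_int_sqrt_scale:
  assumes "r \<in> \<rat>" "r > 0"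
  obtains d l :: nat where "l > 0" "sqrt d = l * sqrt r"
proof -
  obtain m l :: nat where r: "l > 0" "r = m / l"
    using assms Rats_abs_nat_div_natE[of r] by (metis abs_of_pos gr0I)
  then have "real (m * l) = l\<^sup>2 * r" by (simp add: power2_eq_square)
  then have "sqrt (m * l) = l * sqrt r" by (simp only: real_sqrt_mult) simp
  then show thesis using that r by blast
qed

lemma rat_span_affine:
  fixes w :: real
  assumes "c \<in> \<rat>" "e \<in> \<rat>" "e \<noteq> 0" and w: "w = c + e * s"
  shows "{a + b * w |a b. a \<in> \<rat> \<and> b \<in> \<rat>} = {a + b * s |a b. a \<in> \<rat> \<and> b \<in> \<rat>}" (is "?L = ?R")
proof (intro subset_antisym subsetI)
  fix x assume "x \<in> ?L"
  then obtain a b where "a \<in> \<rat>" "b \<in> \<rat>" "x = a + b * w" by blast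
  then show "x \<in> ?R" using assms(1,2)
    by (intro CollectI exI[of _ "a + b * c"] exI[of _ "b * e"]) (auto simp: w algebra_simps)
next
  fix x assume "x \<in> ?R"
  then obtain a b where "a \<in> \<rat>" "b \<in> \<rat>" "x = a + b * s" by blast
  then show "x \<in> ?L" using assms(1-3)
    by (intro CollectI exI[of _ "a - b * c / e"] exI[of _ "b / e"]) (auto simp: w field_simps)
qed

text \<open>Complete the square in \<open>w * w = p + q * w\<close>, then clear the denominator
  under the root.\<close>

lemma real_quadratic_field_sqrt:
  assumes "real_quadratic_field K"
  obtains d :: nat where "sqrt d \<notin> \<rat>" "K = {a + b * sqrt d |a b. a \<in> \<rat> \<and> b \<in> \<rat>}"
proof -
  obtain w where w: "w \<notin> \<rat>" and K: "K = {a + b * w |a b. a \<in> \<rat> \<and> b \<in> \<rat>}"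
    using real_quadratic_field_basis[OF assms] .
  have "0 + 1 * w \<in> K" unfolding K using Rats_0 Rats_1 by blast
  then have "w \<in> K" by simp
  then have "w * w \<in> K"
    using assms subringE(6)[OF subfieldE(1)] by (fastforce simp: real_quadratic_field_def)
  then obtain p q where pq: "p \<in> \<rat>" "q \<in> \<rat>" "w * w = p + q * w"
    unfolding K by auto
  define r where "r = p + (q / 2)\<^sup>2"
  have r: "r = (w - q / 2)\<^sup>2" using pq(3)
    by (simp add: r_def power2_eq_square algebra_simps)
  have "w \<noteq> q / 2" using w Rats_divide[OF pq(2) Rats_number_of] by metis
  then have "r > 0" "r \<in> \<rat>" unfolding r by (simp, unfold r[symmetric] r_def, use pq in auto)
  then obtain d l :: nat where l: "l > 0" "sqrt d = l * sqrt r"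
    using rational_eq_int_sqrt_scale by blast
  \<comment> \<open>The sign of \<open>e\<close> absorbs the absolute value in
    \<open>sqrt r = \<bar>w - q / 2\<bar>\<close>.\<close>
  define e where "e = (if w \<ge> q / 2 then real l else - real l)"
  have e: "e \<in> \<rat>" "e \<noteq> 0" using l by (auto simp: e_def)
  have d: "sqrt d = e * (w - q / 2)" unfolding l r e_def by (simp add: abs_if algebra_simps)
  then have wd: "w = q / 2 + sqrt d / e" using e by (simp add: field_simps)
  show thesis
  proof (rule that)
    show "sqrt d \<notin> \<rat>"
      using w wd e pq by auto
    show "K = {a + b * sqrt d |a b. a \<in> \<rat> \<and> b \<in> \<rat>}"
      unfolding K by (rule rat_span_affine[of "q / 2" "1 / e"]) (use pq e wd in auto)
  qed
qed

text \<open>The generated field lies in \<open>K\<close> by minimality, and it contains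
  \<open>sqrt d\<close> because the affine expression can be solved for it over \<rat>.\<close>

lemma primitive_element_affine_sqrt:
  assumes "real_quadratic_field K" "K = {a + b * sqrt d |a b. a \<in> \<rat> \<and> b \<in> \<rat>}"
    and "r \<in> \<rat>" "t \<in> \<rat>" "t \<noteq> 0"
  shows "primitive_element (r + t * sqrt d) K"
  unfolding primitive_element_def
proof
  let ?\<alpha> = "r + t * sqrt d"
  let ?G = "generate_field real_ring (insert ?\<alpha> \<rat>)"
  have "x \<in> K" if "x \<in> \<rat>" for x
  proof -
    have "x + 0 * sqrt d \<in> K" unfolding assms(2) using that Rats_0 by blast
    then show ?thesis by simp
  qed
  moreover have "?\<alpha> \<in> K" using assms by blast
  ultimately show "?G \<subseteq> K"
    using assms(1)
    by (intro field.generate_field_min_subfield1[OF field_from_type_algebra])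
      (auto simp: real_quadratic_field_def)
  have rat: "x \<in> ?G" if "x \<in> \<rat>" for x using that by (auto intro: generate_field.incl)
  have add: "x + y \<in> ?G" if "x \<in> ?G" "y \<in> ?G" for x y
    using generate_field.eng_add[OF that] by simp
  have mult: "x * y \<in> ?G" if "x \<in> ?G" "y \<in> ?G" for x y
    using generate_field.eng_mult[OF that] by simp
  have \<alpha>: "?\<alpha> \<in> ?G" by (auto intro: generate_field.incl)
  have "(1 / t) * (?\<alpha> + (- r)) \<in> ?G"
    by (rule mult[OF rat add[OF \<alpha> rat]]) (use assms(3,4) in auto)
  then have "sqrt d \<in> ?G" using assms(5) by simp
  then have "a + b * sqrt d \<in> ?G" if "a \<in> \<rat>" "b \<in> \<rat>" for a b
    using that by (intro add[OF rat] mult[OF rat])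
  then show "K \<subseteq> ?G" unfolding assms(2) by blast
qed

section \<open>The common index for all the fields\<close>

theorem theorem4:
  fixes k :: nat and K :: "nat \<Rightarrow> real set"
  assumes "k > 0"
    and "\<And>i. i \<in> {1..k} \<Longrightarrow> real_quadratic_field (K i)"
    and "inj_on K {1..k}"
  shows "\<exists>n::nat. n > 0 \<and> (\<forall>i\<in>{1..k}. \<exists>\<alpha>\<in>I2r (2 * n). primitive_element \<alpha> (K i))"
proof -
  define F where "F w = {a + b * w |a b. a \<in> \<rat> \<and> b \<in> \<rat>}" for w :: real
  have "\<exists>d::nat. sqrt d \<notin> \<rat> \<and> K i = F (sqrt d)" if "i \<in> {1..k}" for i
    unfolding F_def
    by (rule real_quadratic_field_sqrt[OF assms(2)[OF that]], rule exI, rule conjI)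
  then obtain d :: "nat \<Rightarrow> nat" where d: "\<And>i. i \<in> {1..k} \<Longrightarrow> sqrt (d i) \<notin> \<rat>"
    and K: "\<And>i. i \<in> {1..k} \<Longrightarrow> K i = F (sqrt (d i))"
    by metis
  obtain n :: nat where n: "n > 0"
    and ex: "\<And>i. i \<in> {1..k} \<Longrightarrow> \<exists>t::int. n < t * sqrt (d i) \<and> t * sqrt (d i) < n + 1"
    using irrational_sqrts_common_floor[of "{1..k}" d] d by auto
  have "\<exists>\<alpha>\<in>I2r (2 * n). primitive_element \<alpha> (K i)" if i: "i \<in> {1..k}" for i
  proof -
    obtain t :: int where t: "n < t * sqrt (d i)" "t * sqrt (d i) < n + 1"
      using ex[OF i] by auto
    \<comment> \<open>With \<alpha> = \<open>- n + t * sqrt (d i)\<close>, the square of \<alpha> +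
      \<open>n\<close> is \<open>m\<close>, so the constant coefficient is
      \<open>c = n^2 - m\<close>. Strict integer bounds on \<open>m\<close> yield exactly
      \<open>- 2 * n \<le> c \<le> -1\<close>.\<close>
    define m where "m = t\<^sup>2 * int (d i)"
    have m: "real_of_int m = (t * sqrt (d i))\<^sup>2" by (simp add: m_def power_mult_distrib)
    have "(real n)\<^sup>2 < m" "m < (real n + 1)\<^sup>2"
      unfolding m using t by (auto intro!: power_strict_mono)
    then have "real_of_int ((int n)\<^sup>2) < m" "m < real_of_int ((int n + 1)\<^sup>2)" by auto
    then have "(int n)\<^sup>2 < m" "m < (int n + 1)\<^sup>2" by linarith+
    then have "- int (2 * n) \<le> (int n)\<^sup>2 - m" "(int n)\<^sup>2 - m \<le> -1"
      by (auto simp: power2_eq_square algebra_simps)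
    moreover have "(- real n + t * sqrt (d i))\<^sup>2 + real (2 * n) * (- real n + t * sqrt (d i))
        + of_int ((int n)\<^sup>2 - m) = 0"
      by (simp add: m) (simp add: power2_eq_square algebra_simps)
    ultimately have "- real n + t * sqrt (d i) \<in> I2r (2 * n)"
      using t unfolding I2r_def by (auto simp del: of_int_diff)
    moreover have "t \<noteq> 0" using t by auto
    then have "primitive_element (- real n + t * sqrt (d i)) (K i)"
      by (intro primitive_element_affine_sqrt assms(2)[OF i] K[OF i, unfolded F_def]) auto
    ultimately show ?thesis by blast
  qed
  then show ?thesis using n by blast
qed

end
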